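(* Let $n, m, \ell \ge 1$ be integers, let $\Omega \subseteq \mathbb{R}^n$ be open and let $f : \mathbb{R}^m \to \mathbb{R}^\ell$ be Borel-measurable. If $u \in \dot{W}^{1,1}_{\mathrm{loc}}(\Omega, \mathbb{R}^m)$ and $f \circ u \in \dot{W}^{1,1}_{\mathrm{loc}}(\Omega, \mathbb{R}^\ell)$, then for almost every $x \in \Omega$ and every $h \in \mathbb{R}^n$, $$ |Du(x)[h]| \le |D(f \circ u)(x)[h]| \, \limsup_{y \to u(x)} \frac{|y - u(x)|}{|f(y) - f(u(x))|}. $$
   Context: For an open set $\Omega \subseteq \mathbb{R}^n$, $\dot{W}^{1,1}_{\mathrm{loc}}(\Omega, \mathbb{R}^k)$ is the set of (locally integrable) weakly differentiable functions $v : \Omega \to \mathbb{R}^k$ whose weak derivative $Dv$ is locally integrable on $\Omega$. For $h \in \mathbb{R}^n$, $Dv(x)[h] \in \mathbb{R}^k$ is the weak derivative at $x$ (a linear map $\mathbb{R}^n \to \mathbb{R}^k$) applied to $h$. "Almost every" refers to Lebesgue measure. The limsup is taken over $y \in \mathbb{R}^m$ with $y \ne u(x)$, $y \to u(x)$, and takes values in $[0, +\infty]$; the quotient is $+\infty$ when $y \neq u(x)$ and $f(y) = f(u(x))$. When the limsup is $+\infty$, the right-hand side of the inequality is understood to be $+\infty$ (so $0 \cdot \infty = +\infty$) and the inequality is void at that point. *)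

theory Defs
  imports "HOL-Analysis.Analysis"
begin

text \<open>
  Functions on an open set \<open>\<Omega>\<close> are total functions; all notions below depend only on
  their values on \<open>\<Omega>\<close>.
\<close>

definition locally_integrable :: "'a::euclidean_space set \<Rightarrow> ('a \<Rightarrow> 'b::euclidean_space) \<Rightarrow> bool"
  where "locally_integrable \<Omega> v \<longleftrightarrow> (\<forall>K. compact K \<and> K \<subseteq> \<Omega> \<longrightarrow> v absolutely_integrable_on K)"

text \<open>
  \<open>C_diff k \<phi>\<close>: \<open>\<phi>\<close> is of class \<open>C\<^sup>k\<close> on the whole space, expressed by iterating
  derivatives in fixed directions.
\<close>

primrec C_diff :: "nat \<Rightarrow> ('a::euclidean_space \<Rightarrow> real) \<Rightarrow> bool" where
  "C_diff 0 \<phi> \<longleftrightarrow> continuous_on UNIV \<phi>"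
| "C_diff (Suc k) \<phi> \<longleftrightarrow>
     (\<forall>x. \<phi> differentiable (at x)) \<and> (\<forall>h. C_diff k (\<lambda>x. frechet_derivative \<phi> (at x) h))"

text \<open>The test functions \<open>C\<^sub>c\<^sup>\<infinity>(\<Omega>)\<close>, extended by zero to the whole space.\<close>

definition test_functions :: "'a::euclidean_space set \<Rightarrow> ('a \<Rightarrow> real) set" where
  "test_functions \<Omega> = {\<phi>. (\<forall>k. C_diff k \<phi>) \<and>
     compact (closure {x. \<phi> x \<noteq> 0}) \<and> closure {x. \<phi> x \<noteq> 0} \<subseteq> \<Omega>}"

text \<open>
  The derivative takes values in linear maps. Its local integrability is stated direction by
  direction, which in finite dimension is integrability of the operator-valued map; the library
  does not make the type of bounded linear maps an instance of
  \<open>second_countable_topology\<close>, as its Bochner integral requires.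
\<close>

definition has_weak_derivative ::
    "('a::euclidean_space \<Rightarrow> 'b::euclidean_space) \<Rightarrow> ('a \<Rightarrow> 'a \<Rightarrow>\<^sub>L 'b) \<Rightarrow> 'a set \<Rightarrow> bool" where
  "has_weak_derivative v Dv \<Omega> \<longleftrightarrow>
     locally_integrable \<Omega> v \<and>
     (\<forall>h. locally_integrable \<Omega> (\<lambda>x. blinfun_apply (Dv x) h)) \<and>
     (\<forall>\<phi>\<in>test_functions \<Omega>. \<forall>h.
        (LINT x:\<Omega>|lebesgue. frechet_derivative \<phi> (at x) h *\<^sub>R v x) =
        - (LINT x:\<Omega>|lebesgue. \<phi> x *\<^sub>R blinfun_apply (Dv x) h))"

definition W11_loc :: "'a::euclidean_space set \<Rightarrow> ('a \<Rightarrow> 'b::euclidean_space) set" where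
  "W11_loc \<Omega> = {v. \<exists>Dv. has_weak_derivative v Dv \<Omega>}"

text \<open>
  In \<open>ennreal\<close>, \<open>a / 0 = top\<close> for \<open>a \<noteq> 0\<close>, so the quotient is \<open>top\<close> when
  \<open>y \<noteq> z\<close> and \<open>f y = f z\<close>; the filter \<open>at z\<close> excludes \<open>y = z\<close>.
\<close>

definition inverse_slope :: "('b::real_normed_vector \<Rightarrow> 'c::real_normed_vector) \<Rightarrow> 'b \<Rightarrow> ennreal" where
  "inverse_slope f z = Limsup (at z) (\<lambda>y. ennreal (norm (y - z)) / ennreal (norm (f y - f z)))"

text \<open>The product on \<open>[0, \<infinity>]\<close> with \<open>0 \<cdot> \<infinity> = \<infinity>\<close>; \<open>ennreal\<close> has \<open>0 * top = 0\<close>.\<close>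

definition times_top :: "ennreal \<Rightarrow> ennreal \<Rightarrow> ennreal" where
  "times_top a L = (if L = top then top else a * L)"

end

theory Submission
  imports Defs
begin

text \<open>
  The inequality at a point \<open>x\<close> and a direction \<open>h\<close> needs nothing more than one sequence
  \<open>T n\<close> of positive reals tending to \<open>0\<close> along which the difference quotients of \<open>u\<close> and of
  \<open>f \<circ> u\<close> at \<open>x\<close> in direction \<open>h\<close> converge to \<open>Du x h\<close> and \<open>D(f \<circ> u) x h\<close>. If
  \<open>Du x h \<noteq> 0\<close>, the points \<open>u (x + T n h)\<close> are eventually different from \<open>u x\<close> and tend to it, so
  they compete in the limsup, and dividing both increments by \<open>T n\<close> shows that the limsup is at
  least \<open>|Du x h| / |D(f \<circ> u) x h|\<close> (\<open>inverse_slope_bound_along_sequence\<close>). Where the limsup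
  is finite, both sides are continuous in \<open>h\<close>, so it suffices to treat a countable dense set of
  directions, which costs only countably many null sets.

  For fixed \<open>h\<close>, such a sequence exists at almost every \<open>x\<close> because the difference quotients of a
  function with a weak derivative converge in \<open>L\<^sup>1\<close> on small balls, and \<open>L\<^sup>1\<close> convergence gives
  almost everywhere convergence of a subsequence; a common subsequence for \<open>u\<close> and \<open>f \<circ> u\<close> is
  obtained by treating the pair \<open>(u, f \<circ> u)\<close> as one function.

  The \<open>L\<^sup>1\<close> convergence is proved by duality, for scalar \<open>V\<close> with weak directional derivative
  \<open>W\<close>. For a test function \<open>\<phi>\<close>, the function \<open>s \<mapsto> \<integral> V(x + s h) \<phi>(x) dx\<close> is differentiable
  with derivative \<open>\<integral> W(x + s h) \<phi>(x) dx\<close>: moving the translation to \<open>\<phi>\<close>, this is the definition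
  of the weak derivative. The mean value theorem then gives
  \<open>\<integral> \<phi> ((V(x + t h) - V(x)) / t - W(x)) dx = \<integral> \<phi> (W(x + \<xi> h) - W(x)) dx\<close> with
  \<open>0 < \<xi> < t\<close> (\<open>difference_quotient_mean_value\<close>), and the right-hand side is small, uniformly over
  bounded \<open>\<phi>\<close> supported in a fixed ball, because translation is continuous in \<open>L\<^sup>1\<close>
  (\<open>L1_translation_continuous\<close>). Taking for \<open>\<phi>\<close> a fixed bump times polynomials which approximate
  the sign of \<open>(V(x + t h) - V(x)) / t - W(x)\<close> turns this into a bound on the \<open>L\<^sup>1\<close> norm weighted
  with the bump (\<open>weighted_L1_norm_le_by_duality\<close>). The bump is positive on the open ball, which is
  all that almost everywhere convergence requires.
\<close>

section \<open>Polynomial multiples of the standard bump function\<close>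

text \<open>
  For \<open>j = 0\<close> this is the standard smooth function that is flat at \<open>0\<close>. The powers of
  \<open>inverse s\<close> make the family closed under differentiation up to linear combinations.
\<close>
definition flat_exp :: "nat \<Rightarrow> real \<Rightarrow> real" where
  "flat_exp j s = (if s > 0 then exp (- inverse s) * inverse s ^ j else 0)"

lemma flat_exp_nonpos [simp]: "s \<le> 0 \<Longrightarrow> flat_exp j s = 0"
  by (simp add: flat_exp_def)

text \<open>
  The exponential beats every power of \<open>inverse s\<close>. Applied to \<open>j + 1\<close>, this says that the
  difference quotient of \<open>flat_exp j\<close> at \<open>0\<close> tends to \<open>0\<close>.
\<close>
lemma flat_exp_tendsto_0: "(flat_exp j \<longlongrightarrow> 0) (at 0)"
proof -
  have "((\<lambda>s::real. inverse s ^ j / exp (inverse s)) \<longlongrightarrow> 0) (at_right 0)"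
    by (rule filterlim_compose[OF tendsto_power_div_exp_0 filterlim_inverse_at_top_right])
  moreover have "\<forall>\<^sub>F s in at_right 0. inverse s ^ j / exp (inverse s) = flat_exp j s"
    by (auto simp: flat_exp_def exp_minus field_simps eventually_at_right_less
        intro!: eventually_mono[OF eventually_at_right_less])
  ultimately have right: "(flat_exp j \<longlongrightarrow> 0) (at_right 0)"
    by (blast intro: Lim_transform_eventually)
  have "\<forall>\<^sub>F s in at_left 0. 0 = flat_exp j s"
    by (auto simp: eventually_at_left_field intro!: exI[of _ "-1"])
  then have "(flat_exp j \<longlongrightarrow> 0) (at_left 0)"
    by (rule Lim_transform_eventually[OF tendsto_const])
  with right show ?thesis
    by (simp add: filterlim_at_split)
qed

lemma DERIV_flat_exp:
  "(flat_exp j has_real_derivative flat_exp (j + 2) s - real j * flat_exp (j + 1) s) (at s)"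
proof -
  consider "s < 0" | "s = 0" | "s > 0" by linarith
  then show ?thesis
  proof cases
    case 1
    have "((\<lambda>_. 0) has_real_derivative 0) (at s)" by simp
    then have "(flat_exp j has_real_derivative 0) (at s)"
      by (rule DERIV_cong_ev[THEN iffD1, rotated -1])
        (use 1 in \<open>auto intro!: eventually_nhds_in_open[of "{..<0}", THEN eventually_mono]\<close>)
    with 1 show ?thesis by simp
  next
    case 2
    have "\<forall>\<^sub>F y in at 0. flat_exp (j + 1) y = (flat_exp j y - flat_exp j 0) / (y - 0)"
      by (auto simp: flat_exp_def field_simps eventually_at_filter)
    then have "(flat_exp j has_real_derivative 0) (at 0)"
      unfolding has_field_derivative_iff
      by (rule Lim_transform_eventually[OF flat_exp_tendsto_0])
    with 2 show ?thesis by simp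
  next
    case 3
    have "((\<lambda>s. exp (- inverse s) * inverse s ^ j) has_real_derivative
            flat_exp (j + 2) s - real j * flat_exp (j + 1) s) (at s)"
      using 3
      by (auto intro!: derivative_eq_intros simp: flat_exp_def power2_eq_square power_Suc
          simp flip: power_add) (cases j; simp add: field_simps)
    then show ?thesis
      by (rule DERIV_cong_ev[THEN iffD1, rotated -1])
        (use 3 in \<open>auto simp: flat_exp_def intro!: eventually_nhds_in_open[of "{0<..}", THEN eventually_mono]\<close>)
  qed
qed

lemma flat_exp_0_bounds: "0 \<le> flat_exp 0 s" "flat_exp 0 s \<le> 1"
  by (auto simp: flat_exp_def)

lemma flat_exp_0_pos: "0 < s \<Longrightarrow> 0 < flat_exp 0 s"
  by (simp add: flat_exp_def)

lemma real_polynomial_function_has_derivative: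
  fixes p :: "'a::euclidean_space \<Rightarrow> real"
  assumes "real_polynomial_function p"
  shows "\<exists>p'. (\<forall>x. (p has_derivative p' x) (at x)) \<and> (\<forall>h. real_polynomial_function (\<lambda>x. p' x h))"
  using assms
proof (induction rule: real_polynomial_function.induct)
  case (linear f)
  then show ?case
    by (intro exI[of _ "\<lambda>x. f"]) (auto intro: bounded_linear_imp_has_derivative real_polynomial_function.intros)
next
  case (const c)
  then show ?case
    by (intro exI[of _ "\<lambda>x h. 0"]) (auto intro: real_polynomial_function.intros)
next
  case (add f g)
  then obtain f' g' where "\<forall>x. (f has_derivative f' x) (at x)" "\<forall>h. real_polynomial_function (\<lambda>x. f' x h)"
     "\<forall>x. (g has_derivative g' x) (at x)" "\<forall>h. real_polynomial_function (\<lambda>x. g' x h)"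
    by metis
  then show ?case
    by (intro exI[of _ "\<lambda>x h. f' x h + g' x h"]) (auto intro: real_polynomial_function.intros has_derivative_add)
next
  case (mult f g)
  then obtain f' g' where "\<forall>x. (f has_derivative f' x) (at x)" "\<forall>h. real_polynomial_function (\<lambda>x. f' x h)"
     "\<forall>x. (g has_derivative g' x) (at x)" "\<forall>h. real_polynomial_function (\<lambda>x. g' x h)"
    by metis
  with mult.hyps show ?case
    by (intro exI[of _ "\<lambda>x h. f x * g' x h + f' x h * g x"] conjI allI has_derivative_mult
          real_polynomial_function.intros(3,4)) auto
qed

text \<open>
  The weight \<open>flat_exp j (r\<^sup>2 - (x - a) \<bullet> (x - a))\<close> lives on the ball of radius \<open>r\<close> around \<open>a\<close>.
  The class contains every polynomial multiple of the bump with \<open>j = 0\<close>, and the higher \<open>j\<close> and the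
  sums are there to make it closed under directional derivatives. By this closure, differentiability
  of its members already yields their smoothness.
\<close>
inductive_set bump_polys :: "'a::euclidean_space \<Rightarrow> real \<Rightarrow> ('a \<Rightarrow> real) set" for a r where
  poly_times_bump: "real_polynomial_function p \<Longrightarrow>
    (\<lambda>x. p x * flat_exp j (r\<^sup>2 - (x - a) \<bullet> (x - a))) \<in> bump_polys a r"
| sum: "\<phi> \<in> bump_polys a r \<Longrightarrow> \<psi> \<in> bump_polys a r \<Longrightarrow> (\<lambda>x. \<phi> x + \<psi> x) \<in> bump_polys a r"

lemma bump_polys_has_derivative:
  assumes "\<phi> \<in> bump_polys a r"
  shows "\<exists>\<phi>'. (\<forall>x. (\<phi> has_derivative \<phi>' x) (at x)) \<and> (\<forall>h. (\<lambda>x. \<phi>' x h) \<in> bump_polys a r)"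
  using assms
proof induction
  case (poly_times_bump p j)
  then obtain p' where p': "\<And>x. (p has_derivative p' x) (at x)"
      "\<And>h. real_polynomial_function (\<lambda>x. p' x h)"
    using real_polynomial_function_has_derivative by metis
  let ?q = "\<lambda>x. r\<^sup>2 - (x - a) \<bullet> (x - a)"
  let ?d = "\<lambda>x h. p' x h * flat_exp j (?q x) +
     ((p x * (- 2 * ((x - a) \<bullet> h))) * flat_exp (j + 2) (?q x) +
      (p x * (2 * real j * ((x - a) \<bullet> h))) * flat_exp (j + 1) (?q x))"
  have "((\<lambda>x. p x * flat_exp j (?q x)) has_derivative ?d x) (at x)" for x
  proof -
    have q: "(?q has_derivative (\<lambda>h. - 2 * ((x - a) \<bullet> h))) (at x)"
      by (auto intro!: derivative_eq_intros simp: inner_commute)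
    have "((\<lambda>x. flat_exp j (?q x)) has_derivative
        (\<lambda>h. - 2 * ((x - a) \<bullet> h) * (flat_exp (j + 2) (?q x) - real j * flat_exp (j + 1) (?q x)))) (at x)"
      using DERIV_compose_FDERIV[OF DERIV_flat_exp q] .
    from has_derivative_mult[OF p'(1) this] show ?thesis
      by (rule has_derivative_eq_rhs) (auto simp: algebra_simps)
  qed
  moreover have "(\<lambda>x. ?d x h) \<in> bump_polys a r" for h
  proof -
    have lin: "real_polynomial_function (\<lambda>x. c * ((x - a) \<bullet> h))" for c
    proof -
      have "real_polynomial_function (\<lambda>x. c * (x \<bullet> h) + (- c * (a \<bullet> h)))"
        by (intro real_polynomial_function.intros) (auto intro: bounded_linear_intros)
      then show ?thesis by (simp add: algebra_simps)
    qed
    show ?thesis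
      by (intro bump_polys.sum bump_polys.poly_times_bump p' real_polynomial_function.intros(4) poly_times_bump.hyps lin)
  qed
  ultimately show ?case by (intro exI[of _ ?d]) blast
next
  case (sum \<phi> \<psi>)
  then obtain \<phi>' \<psi>' where "\<forall>x. (\<phi> has_derivative \<phi>' x) (at x)" "\<forall>h. (\<lambda>x. \<phi>' x h) \<in> bump_polys a r"
     "\<forall>x. (\<psi> has_derivative \<psi>' x) (at x)" "\<forall>h. (\<lambda>x. \<psi>' x h) \<in> bump_polys a r"
    by metis
  then show ?case
    by (intro exI[of _ "\<lambda>x h. \<phi>' x h + \<psi>' x h"]) (auto intro: bump_polys.intros has_derivative_add)
qed

lemma bump_polys_frechet:
  assumes "\<phi> \<in> bump_polys a r"
  shows "(\<phi> has_derivative frechet_derivative \<phi> (at x)) (at x)"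
    and "(\<lambda>x. frechet_derivative \<phi> (at x) h) \<in> bump_polys a r"
proof -
  obtain \<phi>' where \<phi>': "\<And>x. (\<phi> has_derivative \<phi>' x) (at x)" "\<And>h. (\<lambda>x. \<phi>' x h) \<in> bump_polys a r"
    using bump_polys_has_derivative[OF assms] by metis
  then have "frechet_derivative \<phi> (at x) = \<phi>' x" for x
    by (metis frechet_derivative_at)
  with \<phi>' show "(\<phi> has_derivative frechet_derivative \<phi> (at x)) (at x)"
    and "(\<lambda>x. frechet_derivative \<phi> (at x) h) \<in> bump_polys a r"
    by auto
qed

lemma bump_polys_continuous: "\<phi> \<in> bump_polys a r \<Longrightarrow> continuous_on S \<phi>"
  by (meson bump_polys_frechet(1) has_derivative_continuous continuous_at_imp_continuous_on)

lemma bump_polys_C_diff: "\<phi> \<in> bump_polys a r \<Longrightarrow> C_diff k \<phi>"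
proof (induction k arbitrary: \<phi>)
  case 0
  then show ?case by (simp add: bump_polys_continuous)
next
  case (Suc k)
  then show ?case
    by (auto simp: bump_polys_frechet(2) differentiable_def intro: bump_polys_frechet(1))
qed

lemma bump_polys_outside:
  assumes "\<phi> \<in> bump_polys a r" "0 < r" "x \<notin> cball a r"
  shows "\<phi> x = 0"
  using assms(1)
proof induction
  case (poly_times_bump p j)
  have "r\<^sup>2 \<le> (norm (x - a))\<^sup>2"
    using assms(2,3) by (intro power_mono) (auto simp: dist_norm norm_minus_commute)
  then show ?case by (simp add: power2_norm_eq_inner)
qed simp

lemma bump_polys_bounded:
  assumes "\<phi> \<in> bump_polys a r" "0 < r"
  obtains B where "0 < B" "\<And>x. \<bar>\<phi> x\<bar> \<le> B"
proof -
  have "bounded (\<phi> ` cball a r)"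
    by (intro compact_imp_bounded compact_continuous_image bump_polys_continuous[OF assms(1)] compact_cball)
  then obtain B where "0 < B" "\<forall>x \<in> cball a r. \<bar>\<phi> x\<bar> \<le> B"
    by (auto simp: bounded_pos)
  with bump_polys_outside[OF assms] that show ?thesis
    by (metis abs_zero less_eq_real_def)
qed

lemma bump_polys_test_functions:
  assumes "\<phi> \<in> bump_polys a r" "0 < r" "cball a r \<subseteq> \<Omega>"
  shows "\<phi> \<in> test_functions \<Omega>"
proof -
  have "closure {x. \<phi> x \<noteq> 0} \<subseteq> cball a r"
    using bump_polys_outside[OF assms(1,2)] by (intro closure_minimal) (fastforce intro: ccontr)+
  moreover from this have "compact (closure {x. \<phi> x \<noteq> 0})"
    by (meson bounded_cball bounded_subset closed_closure compact_eq_bounded_closed)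
  ultimately show ?thesis
    using assms(3) bump_polys_C_diff[OF assms(1)] by (auto simp: test_functions_def)
qed

text \<open>
  Translates stay in the class with a shifted centre, so the weak derivative can be tested against
  them as long as the shifted ball remains in the domain.
\<close>
lemma bump_polys_translate:
  assumes "\<phi> \<in> bump_polys a r"
  shows "(\<lambda>x. \<phi> (x - c)) \<in> bump_polys (a + c) r"
  using assms
proof induction
  case (poly_times_bump p j)
  have "polynomial_function (\<lambda>x. x - c)"
    by (intro polynomial_function_diff polynomial_function_id polynomial_function_const)
  from real_polynomial_function_compose[OF this poly_times_bump]
  have "real_polynomial_function (\<lambda>x. p (x - c))" by (simp add: o_def)
  from bump_polys.poly_times_bump[OF this, of j r "a + c"] show ?case by (simp add: algebra_simps)
next
  case (sum \<phi> \<psi>)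
  then show ?case using bump_polys.sum by blast
qed

section \<open>Translation and approximation of Lebesgue integrable functions\<close>

lemma lebesgue_measurable_translation [measurable]:
    "(\<lambda>x::'a::euclidean_space. x + c) \<in> lebesgue \<rightarrow>\<^sub>M lebesgue"
  and distr_lebesgue_translation:
    "distr lebesgue lebesgue (\<lambda>x::'a::euclidean_space. x + c) = lebesgue"
proof -
  have T: "(\<lambda>x::'a. c + (\<Sum>j\<in>Basis. (1 * (x \<bullet> j)) *\<^sub>R j)) = (\<lambda>x. x + c)"
    by (simp add: euclidean_representation add.commute)
  show "(\<lambda>x::'a. x + c) \<in> lebesgue \<rightarrow>\<^sub>M lebesgue"
    using lebesgue_affine_measurable[of "\<lambda>_. 1" c] unfolding T by simp
  have "lebesgue = density (distr lebesgue lebesgue (\<lambda>x::'a. x + c)) (\<lambda>_. 1)"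
    using lebesgue_affine_euclidean[of "\<lambda>_. 1" c] unfolding T by simp
  then show "distr lebesgue lebesgue (\<lambda>x::'a. x + c) = lebesgue"
    by (simp add: density_1)
qed

lemma integrable_lebesgue_translation:
  fixes f :: "'a::euclidean_space \<Rightarrow> real"
  assumes "integrable lebesgue f"
  shows "integrable lebesgue (\<lambda>x. f (x + c))"
proof -
  have "integrable (distr lebesgue lebesgue (\<lambda>x. x + c)) f"
    unfolding distr_lebesgue_translation by (fact assms)
  then show ?thesis
    by (rule integrable_distr[OF lebesgue_measurable_translation])
qed

lemma integral_lebesgue_translation:
  fixes f :: "'a::euclidean_space \<Rightarrow> real"
  assumes "f \<in> borel_measurable lebesgue"
  shows "(LINT x|lebesgue. f (x + c)) = (LINT x|lebesgue. f x)"
  using integral_distr[OF lebesgue_measurable_translation assms] unfolding distr_lebesgue_translation ..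

text \<open>
  A Lebesgue measurable function is almost everywhere a limit of continuous functions. Clipping these
  at \<open>M\<close> does not change the limit, and Stone--Weierstrass replaces the clipped functions on \<open>K\<close> by
  polynomials at the price of a vanishing error, bounded by \<open>1\<close>.
\<close>
lemma bounded_measurable_limit_of_polynomials:
  fixes f :: "'a::euclidean_space \<Rightarrow> real"
  assumes f: "f \<in> borel_measurable lebesgue" and bound: "\<And>x. \<bar>f x\<bar> \<le> M" and K: "compact K"
  obtains p where "\<And>n. real_polynomial_function (p n)" "\<And>n x. x \<in> K \<Longrightarrow> \<bar>p n x\<bar> \<le> M + 1"
    "AE x in lebesgue. x \<in> K \<longrightarrow> (\<lambda>n. p n x) \<longlonglongrightarrow> f x"
proof -
  have "f measurable_on UNIV"
    using f by (intro lebesgue_measurable_imp_measurable_on) auto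
  then obtain N g where N: "negligible N" and g: "\<And>n. continuous_on UNIV (g n)"
      and lim: "\<And>x. x \<notin> N \<Longrightarrow> (\<lambda>n. g n x) \<longlonglongrightarrow> f x"
    by (auto simp: measurable_on_def)
  define c where "c n x = max (- M) (min M (g n x))" for n x
  have cont: "continuous_on K (c n)" for n
    unfolding c_def by (intro continuous_intros continuous_on_subset[OF g]) auto
  have "\<exists>p. real_polynomial_function p \<and> (\<forall>x\<in>K. \<bar>c n x - p x\<bar> < inverse (Suc n))" for n
    by (rule Stone_Weierstrass_real_polynomial_function[OF K cont, of "inverse (Suc n)" n]) auto
  then obtain p where p: "\<And>n. real_polynomial_function (p n)"
      and close: "\<And>n x. x \<in> K \<Longrightarrow> \<bar>c n x - p n x\<bar> < inverse (Suc n)"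
    by metis
  have "0 \<le> M" using bound[of 0] by linarith
  then have "\<bar>c n x\<bar> \<le> M" for n x by (auto simp: c_def)
  moreover have "inverse (real (Suc n)) \<le> 1" for n by (simp add: field_simps)
  ultimately have "\<bar>p n x\<bar> \<le> M + 1" if "x \<in> K" for n x
    using close[OF that, of n] by (smt (verit, ccfv_SIG))
  moreover have "(\<lambda>n. p n x) \<longlonglongrightarrow> f x" if "x \<in> K" "x \<notin> N" for x
  proof -
    have "(\<lambda>n. c n x) \<longlonglongrightarrow> max (- M) (min M (f x))"
      unfolding c_def by (intro tendsto_intros lim that)
    moreover have "max (- M) (min M (f x)) = f x" using bound[of x] by auto
    moreover have "(\<lambda>n. c n x - p n x) \<longlonglongrightarrow> 0"
      using close[OF that(1)]
      by (intro Lim_null_comparison[OF _ LIMSEQ_inverse_real_of_nat]) (auto intro!: always_eventually less_imp_le)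
    ultimately have "(\<lambda>n. c n x - (c n x - p n x)) \<longlonglongrightarrow> f x - 0"
      by (intro tendsto_diff) auto
    then show ?thesis by simp
  qed
  then have "AE x in lebesgue. x \<in> K \<longrightarrow> (\<lambda>n. p n x) \<longlonglongrightarrow> f x"
    using N by (intro AE_I'[of N]) (auto simp: negligible_iff_null_sets)
  ultimately show ?thesis using p that by blast
qed

lemma integrable_bounded_scaleR:
  fixes f :: "'a::euclidean_space \<Rightarrow> real" and g :: "'a \<Rightarrow> 'b::euclidean_space"
  assumes "integrable lebesgue g" "f \<in> borel_measurable lebesgue" "\<And>x. \<bar>f x\<bar> \<le> B"
  shows "integrable lebesgue (\<lambda>x. f x *\<^sub>R g x)"
proof (rule Bochner_Integration.integrable_bound)
  show "integrable lebesgue (\<lambda>x. B *\<^sub>R g x)" using assms(1) by simp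
  show "(\<lambda>x. f x *\<^sub>R g x) \<in> borel_measurable lebesgue"
    using assms(2) borel_measurable_integrable[OF assms(1)] by (rule borel_measurable_scaleR)
  show "AE x in lebesgue. norm (f x *\<^sub>R g x) \<le> norm (B *\<^sub>R g x)"
    using assms(3) by (intro AE_I2) (auto intro!: mult_right_mono intro: order_trans[OF _ abs_ge_self])
qed

lemmas integrable_bounded_mult = integrable_bounded_scaleR[where 'b=real, unfolded real_scaleR_def]

text \<open>
  Truncation of \<open>W\<close> at a high level costs little in \<open>L\<^sup>1\<close> by dominated convergence. The truncated
  function is bounded, hence a dominated limit of polynomials on \<open>K\<close>.
\<close>
lemma polynomial_L1_approximation:
  fixes W :: "'a::euclidean_space \<Rightarrow> real"
  assumes W: "integrable lebesgue W" and K: "compact K" and "0 < e"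
  obtains p where "real_polynomial_function p"
    "integrable lebesgue (\<lambda>x. indicator K x * \<bar>W x - p x\<bar>)"
    "(LINT x|lebesgue. indicator K x * \<bar>W x - p x\<bar>) < e"
proof -
  have KS[measurable]: "K \<in> sets lebesgue" using K by (simp add: borel_compact)
  have W_meas[measurable]: "W \<in> borel_measurable lebesgue" using W by simp
  define T where "T n x = max (- real n) (min (real n) (W x))" for n x
  have T_meas[measurable]: "T n \<in> borel_measurable lebesgue" for n
    unfolding T_def by measurable
  have "(\<lambda>n. LINT x|lebesgue. indicator K x * \<bar>W x - T n x\<bar>) \<longlonglongrightarrow> (LINT x::'a|lebesgue. 0 :: real)"
  proof (rule integral_dominated_convergence[where w="\<lambda>x. \<bar>W x\<bar>"])
    show "AE x in lebesgue. (\<lambda>n. indicator K x * \<bar>W x - T n x\<bar>) \<longlonglongrightarrow> 0"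
    proof (rule AE_I2)
      fix x
      obtain m where "\<bar>W x\<bar> \<le> real m" using real_arch_simple by blast
      then have "\<forall>\<^sub>F n in sequentially. indicator K x * \<bar>W x - T n x\<bar> = 0"
        by (intro eventually_sequentiallyI[of m]) (auto simp: T_def)
      then show "(\<lambda>n. indicator K x * \<bar>W x - T n x\<bar>) \<longlonglongrightarrow> 0"
        by (rule tendsto_eventually)
    qed
  qed (use W in \<open>auto simp: T_def indicator_def\<close>)
  then have "\<forall>\<^sub>F n in sequentially. (LINT x|lebesgue. indicator K x * \<bar>W x - T n x\<bar>) < e / 2"
    using \<open>0 < e\<close> by (intro order_tendstoD) auto
  then obtain n where n: "(LINT x|lebesgue. indicator K x * \<bar>W x - T n x\<bar>) < e / 2"
    by (auto simp: eventually_sequentially)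
  have "\<bar>T n x\<bar> \<le> real n" for x by (auto simp: T_def)
  then obtain p where p: "\<And>k. real_polynomial_function (p k)"
    and pb: "\<And>k x. x \<in> K \<Longrightarrow> \<bar>p k x\<bar> \<le> real n + 1"
    and pl: "AE x in lebesgue. x \<in> K \<longrightarrow> (\<lambda>k. p k x) \<longlonglongrightarrow> T n x"
    using bounded_measurable_limit_of_polynomials[OF T_meas _ K] by blast
  have p_meas[measurable]: "p k \<in> borel_measurable lebesgue" for k
    using p by (auto intro!: measurable_completion borel_measurable_continuous_onI continuous_on_polymonial_function
        simp: real_polynomial_function_eq)
  have ind: "integrable lebesgue (\<lambda>x. indicator K x :: real)"
    using lmeasurable_compact[OF K] by (simp add: lmeasurable_iff_integrable)
  have int: "integrable lebesgue (\<lambda>x. indicator K x * \<bar>f x - g x\<bar>)"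
    if "f \<in> borel_measurable lebesgue" "g \<in> borel_measurable lebesgue" 
      and "\<And>x. x\<in>K \<Longrightarrow> \<bar>f x - g x\<bar> \<le> B + \<bar>W x\<bar>" for f g and B :: real
  proof (rule Bochner_Integration.integrable_bound)
    show "integrable lebesgue (\<lambda>x. indicator K x * B + \<bar>W x\<bar>)" using ind W by auto
  qed (use that KS in \<open>auto simp: indicator_def intro!: AE_I2 order_trans[OF _ abs_ge_self]\<close>)
  have Tp: "\<bar>T n x - p k x\<bar> \<le> 2 * real n + 1" if "x \<in> K" for k x
    using pb[OF that, of k] by (auto simp: T_def)
  have int1: "integrable lebesgue (\<lambda>x. indicator K x * \<bar>W x - T n x\<bar>)"
    by (rule int[where B=0]) (auto simp: T_def)
  have int2: "integrable lebesgue (\<lambda>x. indicator K x * \<bar>T n x - p k x\<bar>)" for k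
    by (rule int[where B="2 * real n + 1"]) (auto intro: order_trans[OF Tp])
  have int3: "integrable lebesgue (\<lambda>x. indicator K x * \<bar>W x - p k x\<bar>)" for k
    by (rule int[where B="real n + 1"]) (auto intro!: order_trans[OF abs_triangle_ineq4] pb)
  have "(\<lambda>k. LINT x|lebesgue. indicator K x * \<bar>T n x - p k x\<bar>) \<longlonglongrightarrow> (LINT x::'a|lebesgue. 0 :: real)"
  proof (rule integral_dominated_convergence[where w="\<lambda>x. (2 * real n + 1) * indicator K x"])
    show "AE x in lebesgue. (\<lambda>k. indicator K x * \<bar>T n x - p k x\<bar>) \<longlonglongrightarrow> 0"
      using pl
    proof eventually_elim
      case (elim x)
      show ?case
      proof (cases "x \<in> K")
        case True
        with elim have "(\<lambda>k. \<bar>T n x - p k x\<bar>) \<longlonglongrightarrow> \<bar>T n x - T n x\<bar>"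
          by (intro tendsto_intros) auto
        with True show ?thesis by simp
      qed simp
    qed
    show "AE x in lebesgue. norm (indicator K x * \<bar>T n x - p k x\<bar>) \<le> (2 * real n + 1) * indicator K x" for k
      using Tp by (intro AE_I2) (auto simp: indicator_def)
  qed (use ind in auto)
  then have "\<forall>\<^sub>F k in sequentially. (LINT x|lebesgue. indicator K x * \<bar>T n x - p k x\<bar>) < e / 2"
    using \<open>0 < e\<close> by (intro order_tendstoD) auto
  then obtain k where k: "(LINT x|lebesgue. indicator K x * \<bar>T n x - p k x\<bar>) < e / 2"
    by (auto simp: eventually_sequentially)
  have "(LINT x|lebesgue. indicator K x * \<bar>W x - p k x\<bar>)
    \<le> (LINT x|lebesgue. indicator K x * \<bar>W x - T n x\<bar> + indicator K x * \<bar>T n x - p k x\<bar>)"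
    by (intro integral_mono int3 Bochner_Integration.integrable_add int1 int2) (auto simp: indicator_def)
  also have "\<dots> < e"
    using n k by (subst Bochner_Integration.integral_add[OF int1 int2]) linarith
  finally show ?thesis using that p int3 by blast
qed

text \<open>
  For a polynomial in place of \<open>W\<close> this is uniform continuity on a compact set. The approximation is
  made on a ball of radius \<open>r + 1\<close>, so that it covers all translates by vectors shorter than \<open>1\<close>.
\<close>
lemma L1_translation_continuous:
  fixes W :: "'a::euclidean_space \<Rightarrow> real"
  assumes W: "integrable lebesgue W" and "0 < e"
  obtains d where "0 < d"
    "\<And>c. norm c < d \<Longrightarrow> (LINT x|lebesgue. indicator (cball a r) x * \<bar>W (x + c) - W x\<bar>) < e"
proof -
  obtain p where p: "real_polynomial_function p"
    and int: "integrable lebesgue (\<lambda>x. indicator (cball a (r + 1)) x * \<bar>W x - p x\<bar>)"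
    and less: "(LINT x|lebesgue. indicator (cball a (r + 1)) x * \<bar>W x - p x\<bar>) < e / 4"
    using polynomial_L1_approximation[OF W compact_cball, of "e/4" a "r + 1"] \<open>0 < e\<close> by auto
  define m where "m = measure lebesgue (cball a r)"
  \<comment> \<open>A uniform error \<open>\<eta>\<close> contributes at most \<open>\<eta> m < e / 2\<close>; the added \<open>1\<close> avoids division by \<open>0\<close>.\<close>
  define \<eta> where "\<eta> = e / (4 * (m + 1))"
  have m0: "0 \<le> m" by (simp add: m_def)
  have "0 < \<eta>" using \<open>0 < e\<close> m0 by (simp add: \<eta>_def)
  have \<eta>: "\<eta> * m < e / 2"
    using \<open>0 < e\<close> m0 by (simp add: \<eta>_def field_simps) (smt (verit) mult_nonneg_nonneg)
  have cont: "continuous_on (cball a (r + 1)) p"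
    using p by (simp add: continuous_on_polymonial_function real_polynomial_function_eq)
  from compact_uniformly_continuous[OF this compact_cball] \<open>0 < \<eta>\<close>
  obtain d where "0 < d" and d: "\<And>x y. x \<in> cball a (r + 1) \<Longrightarrow> y \<in> cball a (r + 1) \<Longrightarrow>
      dist y x < d \<Longrightarrow> dist (p y) (p x) < \<eta>"
    unfolding uniformly_continuous_on_def by metis
  have "(LINT x|lebesgue. indicator (cball a r) x * \<bar>W (x + c) - W x\<bar>) < e" if "norm c < min d 1" for c
  proof -
    let ?E = "\<lambda>x. indicator (cball a (r + 1)) x * \<bar>W x - p x\<bar>"
    have ind: "integrable lebesgue (\<lambda>x. \<eta> * indicator (cball a r) x)"
      using lmeasurable_cball[of a r] by (simp add: lmeasurable_iff_integrable)
    have int': "integrable lebesgue (\<lambda>x. ?E (x + c) + ?E x + \<eta> * indicator (cball a r) x)"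
      by (intro Bochner_Integration.integrable_add integrable_lebesgue_translation int ind)
    have pt: "indicator (cball a r) x * \<bar>W (x + c) - W x\<bar> \<le> ?E (x + c) + ?E x + \<eta> * indicator (cball a r) x" for x
    proof (cases "x \<in> cball a r")
      case True
      have "x + c \<in> cball a (r + 1)" "x \<in> cball a (r + 1)"
        using True that norm_triangle_ineq4[of "a - x" c] by (auto simp: dist_norm algebra_simps)
      moreover from d[OF this(2,1)] that have "\<bar>p (x + c) - p x\<bar> < \<eta>" by (auto simp: dist_norm)
      ultimately show ?thesis using True by auto
    qed (auto simp: indicator_def)
    have "(LINT x|lebesgue. indicator (cball a r) x * \<bar>W (x + c) - W x\<bar>)
       \<le> (LINT x|lebesgue. ?E (x + c) + ?E x + \<eta> * indicator (cball a r) x)"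
      using \<open>0 < \<eta>\<close> by (intro integral_mono' int' pt) auto
    also have "\<dots> = (LINT x|lebesgue. ?E (x + c)) + (LINT x|lebesgue. ?E x) + \<eta> * m"
      unfolding m_def
      by (subst Bochner_Integration.integral_add[OF Bochner_Integration.integrable_add ind]
          Bochner_Integration.integral_add | intro integrable_lebesgue_translation int)+ simp
    also have "(LINT x|lebesgue. ?E (x + c)) = (LINT x|lebesgue. ?E x)"
      by (intro integral_lebesgue_translation borel_measurable_integrable int)
    finally show ?thesis using less \<eta> by linarith
  qed
  with \<open>0 < d\<close> that[of "min d 1"] show ?thesis by auto
qed

text \<open>
  The extremal choice \<open>p = sgn g\<close> would give the conclusion at once. Polynomials \<open>p\<close> can only converge
  to it while staying bounded on \<open>K\<close>; the bound \<open>2\<close> leaves room for the error made by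
  \<open>bounded_measurable_limit_of_polynomials\<close> with \<open>M = 1\<close>.
\<close>
lemma weighted_L1_norm_le_by_duality:
  fixes g b :: "'a::euclidean_space \<Rightarrow> real"
  assumes g: "integrable lebesgue g" and b: "b \<in> borel_measurable lebesgue" "\<And>x. 0 \<le> b x" "\<And>x. b x \<le> 1"
    and K: "compact K" "\<And>x. x \<notin> K \<Longrightarrow> b x = 0"
    and le: "\<And>p. real_polynomial_function p \<Longrightarrow> (\<And>x. x \<in> K \<Longrightarrow> \<bar>p x\<bar> \<le> 2) \<Longrightarrow>
       (LINT x|lebesgue. p x * b x * g x) \<le> C"
  shows "(LINT x|lebesgue. b x * \<bar>g x\<bar>) \<le> C"
proof -
  have g_meas: "g \<in> borel_measurable lebesgue" using g by simp
  have sgn_meas: "(\<lambda>x. sgn (g x)) \<in> borel_measurable lebesgue"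
    using g_meas by measurable
  obtain p where p: "\<And>n. real_polynomial_function (p n)" and pb: "\<And>n x. x \<in> K \<Longrightarrow> \<bar>p n x\<bar> \<le> 2"
    and pl: "AE x in lebesgue. x \<in> K \<longrightarrow> (\<lambda>n. p n x) \<longlonglongrightarrow> sgn (g x)"
    using bounded_measurable_limit_of_polynomials[OF sgn_meas _ K(1), of 1] by (auto simp: abs_sgn_eq)
  have p_meas: "p k \<in> borel_measurable lebesgue" for k
    using p by (auto intro!: measurable_completion borel_measurable_continuous_onI continuous_on_polymonial_function
        simp: real_polynomial_function_eq)
  have "(\<lambda>n. LINT x|lebesgue. p n x * b x * g x) \<longlonglongrightarrow> (LINT x|lebesgue. b x * \<bar>g x\<bar>)"
  proof (rule integral_dominated_convergence[where w="\<lambda>x. 2 * \<bar>g x\<bar>"])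
    show "AE x in lebesgue. (\<lambda>n. p n x * b x * g x) \<longlonglongrightarrow> b x * \<bar>g x\<bar>"
      using pl
    proof eventually_elim
      case (elim x)
      show ?case
      proof (cases "x \<in> K")
        case True
        with elim have "(\<lambda>n. p n x * b x * g x) \<longlonglongrightarrow> sgn (g x) * b x * g x"
          by (intro tendsto_intros) auto
        then show ?thesis by (simp add: abs_sgn mult.commute mult.left_commute)
      qed (simp add: K(2))
    qed
    show "AE x in lebesgue. norm (p n x * b x * g x) \<le> 2 * \<bar>g x\<bar>" for n
    proof (rule AE_I2)
      fix x
      have "\<bar>p n x * b x\<bar> \<le> 2 * 1"
      proof (cases "x \<in> K")
        case True
        then show ?thesis unfolding abs_mult using pb[of x n] b(2,3)[of x] by (intro mult_mono) auto
      qed (simp add: K(2))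
      then show "norm (p n x * b x * g x) \<le> 2 * \<bar>g x\<bar>"
        by (simp add: abs_mult mult_right_mono)
    qed
  qed (use g b p_meas in auto)
  then show ?thesis
    by (rule LIMSEQ_le_const2) (use le[OF p pb] in auto)
qed

section \<open>Convergence of difference quotients in a weighted \<open>L\<^sup>1\<close> norm\<close>

lemma bump_polys_measurable: "\<phi> \<in> bump_polys a r \<Longrightarrow> \<phi> \<in> borel_measurable lebesgue"
  by (intro measurable_completion) (simp add: borel_measurable_continuous_onI bump_polys_continuous)

lemma bump_polys_DERIV_line:
  assumes "\<phi> \<in> bump_polys a r"
  shows "((\<lambda>s. \<phi> (y + s *\<^sub>R h)) has_real_derivative frechet_derivative \<phi> (at (y + s *\<^sub>R h)) h) (at s)"
proof -
  let ?D = "frechet_derivative \<phi> (at (y + s *\<^sub>R h))"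
  have D: "(\<phi> has_derivative ?D) (at (y + s *\<^sub>R h))"
    by (rule bump_polys_frechet(1)[OF assms])
  have "((\<lambda>s. y + s *\<^sub>R h) has_derivative (\<lambda>e. e *\<^sub>R h)) (at s)"
    by (auto intro!: derivative_eq_intros)
  from has_derivative_compose[OF this D]
  have "((\<lambda>s. \<phi> (y + s *\<^sub>R h)) has_derivative (\<lambda>e. ?D (e *\<^sub>R h))) (at s)" .
  moreover have "?D (e *\<^sub>R h) = ?D h * e" for e
    using linear_scale[OF has_derivative_linear[OF D], of e h] by simp
  ultimately show ?thesis by (simp add: has_field_derivative_def)
qed

lemma bump_polys_Lipschitz_line:
  assumes "\<phi> \<in> bump_polys a r" "0 < r"
  obtains B where "0 < B" "\<And>y s t. \<bar>\<phi> (y + s *\<^sub>R h) - \<phi> (y + t *\<^sub>R h)\<bar> \<le> B * \<bar>s - t\<bar>"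
proof -
  obtain B where "0 < B" and B: "\<And>x. \<bar>frechet_derivative \<phi> (at x) h\<bar> \<le> B"
    using bump_polys_bounded[OF bump_polys_frechet(2)[OF assms(1)] assms(2)] by metis
  have "norm (\<phi> (y + s *\<^sub>R h) - \<phi> (y + t *\<^sub>R h)) \<le> B * norm (s - t)" for y s t
    by (rule field_differentiable_bound[OF convex_UNIV bump_polys_DERIV_line[OF assms(1)]])
      (auto simp: B)
  with \<open>0 < B\<close> that show ?thesis by (auto simp: dist_norm)
qed

text \<open>
  Differentiation under the integral by dominated convergence: the Lipschitz constant of \<open>\<phi>\<close> along
  \<open>h\<close> bounds all its difference quotients.
\<close>
lemma DERIV_integral_translated_bump:
  assumes V: "integrable lebesgue V" and \<phi>: "\<phi> \<in> bump_polys a r" and "0 < r"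
  shows "((\<lambda>s. LINT y|lebesgue. \<phi> (y - s *\<^sub>R h) * V y) has_real_derivative
     - (LINT y|lebesgue. frechet_derivative \<phi> (at (y - s *\<^sub>R h)) h * V y)) (at s)"
proof -
  let ?D = "\<lambda>x. frechet_derivative \<phi> (at x) h"
  obtain B where B: "0 < B" "\<And>y s t. \<bar>\<phi> (y + s *\<^sub>R (- h)) - \<phi> (y + t *\<^sub>R (- h))\<bar> \<le> B * \<bar>s - t\<bar>"
    using bump_polys_Lipschitz_line[OF \<phi> \<open>0 < r\<close>] by metis
  note D = bump_polys_frechet(2)[OF \<phi>, of h]
  obtain C where C: "\<And>x. \<bar>\<phi> x\<bar> \<le> C"
    using bump_polys_bounded[OF \<phi> \<open>0 < r\<close>] by metis
  have meas: "(\<lambda>y. \<phi> (y - c)) \<in> borel_measurable lebesgue" "(\<lambda>y. ?D (y - c)) \<in> borel_measurable lebesgue" for c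
    by (rule bump_polys_measurable[OF bump_polys_translate[OF \<phi>]]
        bump_polys_measurable[OF bump_polys_translate[OF D]])+
  have V_meas: "V \<in> borel_measurable lebesgue" using V by simp
  have int: "integrable lebesgue (\<lambda>y. \<phi> (y - c) * V y)" for c
    by (rule integrable_bounded_mult[OF V meas(1) C])
  have "(\<lambda>n. ((LINT y|lebesgue. \<phi> (y - (s + X n) *\<^sub>R h) * V y) -
          (LINT y|lebesgue. \<phi> (y - s *\<^sub>R h) * V y)) / X n) \<longlonglongrightarrow>
        - (LINT y|lebesgue. ?D (y - s *\<^sub>R h) * V y)"
    if X: "\<And>n. X n \<noteq> 0" "X \<longlonglongrightarrow> 0" for X
  proof -
    let ?q = "\<lambda>n y. (\<phi> (y - (s + X n) *\<^sub>R h) - \<phi> (y - s *\<^sub>R h)) / X n"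
    have "(\<lambda>n. LINT y|lebesgue. ?q n y * V y) \<longlonglongrightarrow> (LINT y|lebesgue. - ?D (y - s *\<^sub>R h) * V y)"
    proof (rule integral_dominated_convergence[where w="\<lambda>y. B * \<bar>V y\<bar>"])
      show "AE y in lebesgue. (\<lambda>n. ?q n y * V y) \<longlonglongrightarrow> - ?D (y - s *\<^sub>R h) * V y"
      proof (intro AE_I2 tendsto_mult tendsto_const)
        fix y
        have lin: "linear (frechet_derivative \<phi> (at (y - s *\<^sub>R h)))"
          using has_derivative_linear[OF bump_polys_frechet(1)[OF \<phi>]] .
        have "((\<lambda>s. \<phi> (y - s *\<^sub>R h)) has_real_derivative - ?D (y - s *\<^sub>R h)) (at s)"
          using bump_polys_DERIV_line[OF \<phi>, of y "- h" s]
          by (simp add: linear_neg[OF lin])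
        then have "((\<lambda>e. (\<phi> (y - (s + e) *\<^sub>R h) - \<phi> (y - s *\<^sub>R h)) / e) \<longlongrightarrow> - ?D (y - s *\<^sub>R h)) (at 0)"
          by (simp add: DERIV_def)
        then show "(\<lambda>n. ?q n y) \<longlonglongrightarrow> - ?D (y - s *\<^sub>R h)"
          using X unfolding tendsto_at_iff_sequentially o_def by auto
      qed
      show "AE y in lebesgue. norm (?q n y * V y) \<le> B * \<bar>V y\<bar>" for n
      proof (rule AE_I2)
        fix y
        have "\<bar>?q n y\<bar> \<le> B"
          using B(2)[of y "s + X n" s] X(1)[of n] by (simp add: field_simps)
        then show "norm (?q n y * V y) \<le> B * \<bar>V y\<bar>"
          unfolding real_norm_def abs_mult[of "?q n y"] by (rule mult_right_mono) simp
      qed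
    qed (use V V_meas meas in \<open>auto intro!: borel_measurable_times borel_measurable_divide borel_measurable_diff\<close>)
    moreover have "(LINT y|lebesgue. ?q n y * V y) =
        ((LINT y|lebesgue. \<phi> (y - (s + X n) *\<^sub>R h) * V y) -
          (LINT y|lebesgue. \<phi> (y - s *\<^sub>R h) * V y)) / X n" for n
      by (subst Bochner_Integration.integral_diff[symmetric, OF int int],
          subst Bochner_Integration.integral_divide_zero[symmetric]) (simp add: field_simps)
    ultimately show ?thesis
      by (simp only: mult_minus_left Bochner_Integration.integral_minus)
  qed
  then show ?thesis
    unfolding DERIV_def tendsto_at_iff_sequentially o_def by auto
qed

text \<open>
  Let \<open>G s = \<integral> \<phi>(y - s h) V(y) dy = \<integral> \<phi>(x) V(x + s h) dx\<close>. By the previous lemma and the weak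
  derivative relation for the translate of \<open>\<phi>\<close>, the derivative of \<open>G\<close> is
  \<open>\<integral> \<phi>(y - s h) W(y) dy\<close>, and the claim is the mean value theorem for \<open>G\<close> on \<open>[0, t]\<close>. The
  hypothesis on \<open>R\<close> keeps the supports of all translates with \<open>0 \<le> s \<le> t\<close> in the ball on which
  the relation is known.
\<close>
lemma difference_quotient_mean_value:
  fixes V W :: "'a::euclidean_space \<Rightarrow> real"
  assumes V: "integrable lebesgue V" and W: "integrable lebesgue W"
    and weak: "\<And>b \<psi>. cball b r \<subseteq> cball a R \<Longrightarrow> \<psi> \<in> bump_polys b r \<Longrightarrow>
      (LINT x|lebesgue. frechet_derivative \<psi> (at x) h * V x) = - (LINT x|lebesgue. \<psi> x * W x)"
    and \<phi>: "\<phi> \<in> bump_polys a r" and r: "0 < r" and t: "0 < t" "r + t * norm h \<le> R"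
  obtains \<xi> where "0 < \<xi>" "\<xi> < t"
    "(LINT x|lebesgue. \<phi> x * ((V (x + t *\<^sub>R h) - V x) / t - W x)) =
     (LINT x|lebesgue. \<phi> x * (W (x + \<xi> *\<^sub>R h) - W x))"
proof -
  let ?G = "\<lambda>s. LINT y|lebesgue. \<phi> (y - s *\<^sub>R h) * V y"
  obtain C where C: "\<And>x. \<bar>\<phi> x\<bar> \<le> C"
    using bump_polys_bounded[OF \<phi> r] by metis
  have int: "integrable lebesgue (\<lambda>y. \<phi> (y - c) * f y)" if "integrable lebesgue f" for f c
    by (rule integrable_bounded_mult[OF that bump_polys_measurable[OF bump_polys_translate[OF \<phi>]] C])
  have trans: "(LINT y|lebesgue. \<phi> (y - c) * f y) = (LINT x|lebesgue. \<phi> x * f (x + c))"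
    "integrable lebesgue (\<lambda>x. \<phi> x * f (x + c))"
    if "integrable lebesgue f" for f c
    using integral_lebesgue_translation[of "\<lambda>y. \<phi> (y - c) * f y" c]
      integrable_lebesgue_translation[OF int[OF that], of c c] int[OF that]
    by (auto dest: borel_measurable_integrable)
  have "(?G has_real_derivative (LINT y|lebesgue. \<phi> (y - s *\<^sub>R h) * W y)) (at s)" if s: "0 \<le> s" "s \<le> t" for s
  proof -
    have "s * norm h \<le> t * norm h" using s by (intro mult_right_mono) auto
    then have "cball (a + s *\<^sub>R h) r \<subseteq> cball a R"
      using t(2) s(1) by (intro cball_subset_cball_iff[THEN iffD2] disjI1) (simp add: dist_norm)
    from weak[OF this bump_polys_translate[OF \<phi>]]
    have "(LINT x|lebesgue. frechet_derivative (\<lambda>x. \<phi> (x - s *\<^sub>R h)) (at x) h * V x) =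
       - (LINT x|lebesgue. \<phi> (x - s *\<^sub>R h) * W x)" .
    moreover have "frechet_derivative (\<lambda>x. \<phi> (x - s *\<^sub>R h)) (at x) = frechet_derivative \<phi> (at (x - s *\<^sub>R h))" for x
    proof -
      have "((\<lambda>x. x - s *\<^sub>R h) has_derivative (\<lambda>x. x)) (at x)"
        by (auto intro!: derivative_eq_intros)
      from has_derivative_compose[OF this bump_polys_frechet(1)[OF \<phi>]]
      show ?thesis by (metis frechet_derivative_at)
    qed
    ultimately show ?thesis
      using DERIV_integral_translated_bump[OF V \<phi> r, of h s] by simp
  qed
  then obtain \<xi> where \<xi>: "0 < \<xi>" "\<xi> < t"
      "?G t - ?G 0 = (t - 0) * (LINT y|lebesgue. \<phi> (y - \<xi> *\<^sub>R h) * W y)"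
    using MVT2[OF \<open>0 < t\<close>, of ?G "\<lambda>s. LINT y|lebesgue. \<phi> (y - s *\<^sub>R h) * W y"] by blast
  have "(LINT x|lebesgue. \<phi> x * ((V (x + t *\<^sub>R h) - V x) / t - W x))
     = (LINT x|lebesgue. (\<phi> x * V (x + t *\<^sub>R h) - \<phi> x * V (x + 0)) / t - \<phi> x * W (x + 0))"
    by (rule arg_cong[where f="integral\<^sup>L lebesgue"]) (auto simp: algebra_simps diff_divide_distrib)
  also have "\<dots> = (?G t - ?G 0) / t - (LINT x|lebesgue. \<phi> x * W (x + 0))"
    using trans(1)[OF V, of "t *\<^sub>R h"] trans(1)[OF V, of 0]
    by (subst Bochner_Integration.integral_diff Bochner_Integration.integral_divide_zero
        | intro trans V W Bochner_Integration.integrable_diff integrable_divide_zero)+ simp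
  also have "\<dots> = (LINT x|lebesgue. \<phi> x * W (x + \<xi> *\<^sub>R h)) - (LINT x|lebesgue. \<phi> x * W (x + 0))"
    using \<xi>(3) t(1) trans(1)[OF W, of "\<xi> *\<^sub>R h"] by simp
  also have "\<dots> = (LINT x|lebesgue. \<phi> x * (W (x + \<xi> *\<^sub>R h) - W x))"
    by (subst Bochner_Integration.integral_diff[symmetric]) (use trans(2)[OF W, of 0] in \<open>auto intro: trans(2)[OF W] simp: algebra_simps\<close>)
  finally show ?thesis using \<xi> that by blast
qed

text \<open>
  Against \<open>\<phi> = p b\<close> with the bump \<open>b \<le> 1\<close> and \<open>|p| \<le> 2\<close> on the ball, the mean value identity bounds the
  integral by twice the \<open>L\<^sup>1\<close> modulus of continuity of \<open>W\<close>, uniformly in \<open>p\<close>. Duality concludes.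
\<close>
lemma difference_quotient_weighted_L1:
  fixes V W :: "'a::euclidean_space \<Rightarrow> real"
  assumes V: "integrable lebesgue V" and W: "integrable lebesgue W"
    and weak: "\<And>b \<psi>. cball b r \<subseteq> cball a R \<Longrightarrow> \<psi> \<in> bump_polys b r \<Longrightarrow>
      (LINT x|lebesgue. frechet_derivative \<psi> (at x) h * V x) = - (LINT x|lebesgue. \<psi> x * W x)"
    and r: "0 < r" "r < R" and "0 < e"
  shows "\<exists>d>0. \<forall>t. 0 < t \<longrightarrow> t < d \<longrightarrow>
    (LINT x|lebesgue. flat_exp 0 (r\<^sup>2 - (x - a) \<bullet> (x - a)) * \<bar>(V (x + t *\<^sub>R h) - V x) / t - W x\<bar>) < e"
proof -
  let ?b = "\<lambda>x. flat_exp 0 (r\<^sup>2 - (x - a) \<bullet> (x - a))"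
  have poly_bump: "(\<lambda>x. p x * ?b x) \<in> bump_polys a r" if "real_polynomial_function p" for p
    by (rule bump_polys.poly_times_bump[OF that])
  from this[of "\<lambda>_. 1"] have b: "?b \<in> bump_polys a r" by (simp add: real_polynomial_function.intros(2))
  obtain d0 where "0 < d0" and d0: "\<And>c. norm c < d0 \<Longrightarrow>
      (LINT x|lebesgue. indicator (cball a r) x * \<bar>W (x + c) - W x\<bar>) < e / 4"
    using L1_translation_continuous[OF W, of "e/4" a r] \<open>0 < e\<close> by auto
  \<comment> \<open>For \<open>t < d\<close>, the vector \<open>t h\<close> is shorter than \<open>d0\<close>, so \<open>W\<close> moves little in \<open>L\<^sup>1\<close>, and shorter
    than \<open>R - r\<close>, so translated test functions stay in the big ball. The added \<open>1\<close> covers \<open>h = 0\<close>.\<close>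
  define d where "d = min d0 (R - r) / (norm h + 1)"
  have h1: "0 < norm h + 1" by (simp add: add_nonneg_pos)
  have "0 < d" unfolding d_def using \<open>0 < d0\<close> r h1 by simp
  moreover have "(LINT x|lebesgue. ?b x * \<bar>(V (x + t *\<^sub>R h) - V x) / t - W x\<bar>) < e"
    if t: "0 < t" "t < d" for t
  proof -
    have "t * (norm h + 1) < min d0 (R - r)"
      using t(2) h1 by (simp add: d_def pos_less_divide_eq del: min_less_iff_conj)
    then have th: "t * norm h < d0" "r + t * norm h \<le> R"
      using t(1) by (auto simp: algebra_simps)
    have "(LINT x|lebesgue. ?b x * \<bar>(V (x + t *\<^sub>R h) - V x) / t - W x\<bar>) \<le> e / 2"
    proof (rule weighted_L1_norm_le_by_duality[where K="cball a r"])
      show "integrable lebesgue (\<lambda>x. (V (x + t *\<^sub>R h) - V x) / t - W x)"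
        by (intro Bochner_Integration.integrable_diff integrable_divide_zero integrable_lebesgue_translation V W)
      show "?b \<in> borel_measurable lebesgue" by (rule bump_polys_measurable[OF b])
      show "?b x = 0" if "x \<notin> cball a r" for x
        by (rule bump_polys_outside[OF b r(1) that])
    next
      fix p :: "'a \<Rightarrow> real" assume p: "real_polynomial_function p" and p2: "\<And>x. x \<in> cball a r \<Longrightarrow> \<bar>p x\<bar> \<le> 2"
      note \<phi> = poly_bump[OF p]
      obtain \<xi> where \<xi>: "0 < \<xi>" "\<xi> < t"
        and eq: "(LINT x|lebesgue. (p x * ?b x) * ((V (x + t *\<^sub>R h) - V x) / t - W x)) =
                 (LINT x|lebesgue. (p x * ?b x) * (W (x + \<xi> *\<^sub>R h) - W x))"
        by (rule difference_quotient_mean_value[OF V W _ \<phi> r(1) t(1) th(2)]) (rule weak)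
      have "\<xi> * norm h \<le> t * norm h" using \<xi> by (intro mult_right_mono) auto
      with th(1) \<xi>(1) have "norm (\<xi> *\<^sub>R h) < d0" by simp
      note small = d0[OF this]
      have le: "p x * ?b x * (W (x + \<xi> *\<^sub>R h) - W x) \<le> 2 * (indicator (cball a r) x * \<bar>W (x + \<xi> *\<^sub>R h) - W x\<bar>)" for x
      proof (cases "x \<in> cball a r")
        case True
        have "\<bar>p x * ?b x\<bar> \<le> 2 * 1"
          unfolding abs_mult using p2[OF True] by (intro mult_mono) (auto simp: flat_exp_0_bounds)
        then have "\<bar>p x * ?b x * (W (x + \<xi> *\<^sub>R h) - W x)\<bar> \<le> 2 * \<bar>W (x + \<xi> *\<^sub>R h) - W x\<bar>"
          unfolding abs_mult[of "p x * ?b x"] by (intro mult_right_mono) auto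
        with True show ?thesis by simp
      qed (use bump_polys_outside[OF b r(1)] in simp)
      have "(LINT x|lebesgue. p x * ?b x * (W (x + \<xi> *\<^sub>R h) - W x))
         \<le> (LINT x|lebesgue. 2 * (indicator (cball a r) x * \<bar>W (x + \<xi> *\<^sub>R h) - W x\<bar>))"
      proof (rule integral_mono')
        show "integrable lebesgue (\<lambda>x. 2 * (indicator (cball a r) x * \<bar>W (x + \<xi> *\<^sub>R h) - W x\<bar>))"
          by (intro integrable_mult_right integrable_bounded_mult[where B=1] integrable_abs
             Bochner_Integration.integrable_diff integrable_lebesgue_translation W borel_measurable_indicator) (auto simp: indicator_def)
      qed (use le in auto)
      also have "\<dots> \<le> e / 2" using small by simp
      finally show "(LINT x|lebesgue. p x * ?b x * ((V (x + t *\<^sub>R h) - V x) / t - W x)) \<le> e / 2"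
        using eq by simp
    qed (auto simp: flat_exp_0_bounds)
    with \<open>0 < e\<close> show ?thesis by linarith
  qed
  ultimately show ?thesis by blast
qed

section \<open>Difference quotients converge to the weak derivative almost everywhere\<close>

text \<open>
  Cutting off by the indicator of a ball makes the functions globally integrable, so that they can be
  translated freely; it does not affect the defining relation for test functions supported in
  the ball.
\<close>
lemma weak_derivative_component:
  fixes v :: "'a::euclidean_space \<Rightarrow> 'b::euclidean_space"
  assumes v: "has_weak_derivative v Dv \<Omega>" and K: "cball a R \<subseteq> \<Omega>"
  shows "integrable lebesgue (\<lambda>x. indicator (cball a R) x * (v x \<bullet> i))"
    and "integrable lebesgue (\<lambda>x. indicator (cball a R) x * (blinfun_apply (Dv x) h \<bullet> i))"
    and "\<lbrakk>0 < r; cball b r \<subseteq> cball a R; \<psi> \<in> bump_polys b r\<rbrakk> \<Longrightarrow>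
      (LINT x|lebesgue. frechet_derivative \<psi> (at x) h * (indicator (cball a R) x * (v x \<bullet> i))) =
      - (LINT x|lebesgue. \<psi> x * (indicator (cball a R) x * (blinfun_apply (Dv x) h \<bullet> i)))"
proof -
  let ?I = "\<lambda>x. indicator (cball a R) x :: real"
  have int: "integrable lebesgue (\<lambda>x. ?I x *\<^sub>R v x)" "integrable lebesgue (\<lambda>x. ?I x *\<^sub>R blinfun_apply (Dv x) h)"
    using v K by (auto simp: has_weak_derivative_def locally_integrable_def set_integrable_def)
  from this[THEN integrable_inner_left[of i]]
  show "integrable lebesgue (\<lambda>x. ?I x * (v x \<bullet> i))" "integrable lebesgue (\<lambda>x. ?I x * (blinfun_apply (Dv x) h \<bullet> i))"
    by simp_all
  assume r: "0 < r" and sub: "cball b r \<subseteq> cball a R" and \<psi>: "\<psi> \<in> bump_polys b r"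
  have comp: "(LINT x|lebesgue. \<phi> x * (?I x * (g x \<bullet> i))) = (LINT x:\<Omega>|lebesgue. \<phi> x *\<^sub>R g x) \<bullet> i"
    if g: "integrable lebesgue (\<lambda>x. ?I x *\<^sub>R g x)" and \<phi>: "\<phi> \<in> bump_polys b r" for \<phi> and g :: "'a \<Rightarrow> 'b"
  proof -
    obtain B where "\<And>x. \<bar>\<phi> x\<bar> \<le> B" using bump_polys_bounded[OF \<phi> r] by metis
    then have int: "integrable lebesgue (\<lambda>x. \<phi> x *\<^sub>R ?I x *\<^sub>R g x)"
      by (rule integrable_bounded_scaleR[OF g bump_polys_measurable[OF \<phi>]])
    have eq: "\<phi> x *\<^sub>R ?I x *\<^sub>R g x = indicator \<Omega> x *\<^sub>R \<phi> x *\<^sub>R g x" for x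
      using bump_polys_outside[OF \<phi> r, of x] sub K by (cases "x \<in> cball b r") (auto simp: indicator_def)
    have "(LINT x|lebesgue. \<phi> x * (?I x * (g x \<bullet> i))) = (LINT x|lebesgue. \<phi> x *\<^sub>R ?I x *\<^sub>R g x) \<bullet> i"
      by (subst integral_inner_left[OF int, symmetric]) (simp add: mult.assoc)
    then show ?thesis unfolding set_lebesgue_integral_def eq .
  qed
  have "\<psi> \<in> test_functions \<Omega>"
    using bump_polys_test_functions[OF \<psi> r] sub K by blast
  then have "(LINT x:\<Omega>|lebesgue. frechet_derivative \<psi> (at x) h *\<^sub>R v x) =
        - (LINT x:\<Omega>|lebesgue. \<psi> x *\<^sub>R blinfun_apply (Dv x) h)"
    using v by (auto simp: has_weak_derivative_def)
  then show "(LINT x|lebesgue. frechet_derivative \<psi> (at x) h * (?I x * (v x \<bullet> i))) =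
      - (LINT x|lebesgue. \<psi> x * (?I x * (blinfun_apply (Dv x) h \<bullet> i)))"
    by (simp add: comp[OF int(1) bump_polys_frechet(2)[OF \<psi>]] comp[OF int(2) \<psi>])
qed

text \<open>
  The weighted \<open>L\<^sup>1\<close> errors of all components are added up before the subsequence is extracted, which
  makes it common to all components. At a point of the open ball the bump is positive and can be
  divided out, and the cut-off is invisible for small increments.
\<close>
lemma difference_quotient_AE_subsequence:
  fixes v w :: "'a::euclidean_space \<Rightarrow> 'b::euclidean_space"
  assumes V: "\<And>i. i \<in> Basis \<Longrightarrow> integrable lebesgue (\<lambda>x. indicator (cball a R) x * (v x \<bullet> i))"
    and W: "\<And>i. i \<in> Basis \<Longrightarrow> integrable lebesgue (\<lambda>x. indicator (cball a R) x * (w x \<bullet> i))"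
    and weak: "\<And>i b \<psi>. i \<in> Basis \<Longrightarrow> cball b r \<subseteq> cball a R \<Longrightarrow> \<psi> \<in> bump_polys b r \<Longrightarrow>
      (LINT x|lebesgue. frechet_derivative \<psi> (at x) h * (indicator (cball a R) x * (v x \<bullet> i))) =
      - (LINT x|lebesgue. \<psi> x * (indicator (cball a R) x * (w x \<bullet> i)))"
    and r: "0 < r" "r < R"
  obtains T :: "nat \<Rightarrow> real" where "\<And>n. 0 < T n" "T \<longlonglongrightarrow> 0"
    "AE x in lebesgue. x \<in> ball a r \<longrightarrow> (\<lambda>n. (v (x + T n *\<^sub>R h) - v x) /\<^sub>R T n) \<longlonglongrightarrow> w x"
proof -
  let ?I = "\<lambda>x. indicator (cball a R) x :: real"
  let ?b = "\<lambda>x. flat_exp 0 (r\<^sup>2 - (x - a) \<bullet> (x - a))"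
  define E where "E t i x = ?b x * \<bar>(?I (x + t *\<^sub>R h) * (v (x + t *\<^sub>R h) \<bullet> i) - ?I x * (v x \<bullet> i)) / t
     - ?I x * (w x \<bullet> i)\<bar>" for t i x
  define t where "t n = inverse (real (Suc n))" for n
  have t_pos: "0 < t n" for n by (simp add: t_def)
  have t_lim: "t \<longlonglongrightarrow> 0" unfolding t_def by (rule LIMSEQ_inverse_real_of_nat)
  have E0: "0 \<le> E t i x" for t i x by (simp add: E_def flat_exp_0_bounds)
  have b: "?b \<in> bump_polys a r"
    using bump_polys.poly_times_bump[of "\<lambda>_. 1" 0 r a] by (simp add: real_polynomial_function.intros(2))
  have int: "integrable lebesgue (E s i)" if "i \<in> Basis" for s i
    unfolding E_def
    by (intro integrable_bounded_mult[where B=1] integrable_abs Bochner_Integration.integrable_diff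
        integrable_divide_zero integrable_lebesgue_translation[OF V[OF that]] V W that bump_polys_measurable[OF b])
      (simp add: flat_exp_0_bounds)
  have lim: "(\<lambda>n. LINT x|lebesgue. E (t n) i x) \<longlonglongrightarrow> 0" if i: "i \<in> Basis" for i
  proof (rule tendstoI)
    fix e :: real assume "0 < e"
    obtain d where "0 < d" and d: "\<And>s. 0 < s \<Longrightarrow> s < d \<Longrightarrow> (LINT x|lebesgue. E s i x) < e"
    proof -
      have "\<exists>d>0. \<forall>s. 0 < s \<longrightarrow> s < d \<longrightarrow> (LINT x|lebesgue. E s i x) < e"
        unfolding E_def
        by (rule difference_quotient_weighted_L1[OF V[OF i] W[OF i] _ r \<open>0 < e\<close>]) (rule weak[OF i])
      with that show thesis by blast
    qed
    have "\<forall>\<^sub>F n in sequentially. t n < d"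
      using order_tendstoD(2)[OF t_lim \<open>0 < d\<close>] .
    then show "\<forall>\<^sub>F n in sequentially. dist (LINT x|lebesgue. E (t n) i x) 0 < e"
      by eventually_elim (use d t_pos E0 in \<open>auto simp: abs_of_nonneg integral_nonneg\<close>)
  qed
  define Q where "Q n x = (\<Sum>i\<in>Basis. E (t n) i x)" for n x
  have Q0: "0 \<le> Q n x" for n x by (simp add: Q_def E0 sum_nonneg)
  have "integrable lebesgue (Q n)" for n
    unfolding Q_def by (intro Bochner_Integration.integrable_sum int)
  moreover have "(\<lambda>n. LINT x|lebesgue. norm (Q n x)) \<longlonglongrightarrow> 0"
  proof -
    have "(LINT x|lebesgue. norm (Q n x)) = (\<Sum>i\<in>Basis. LINT x|lebesgue. E (t n) i x)" for n
      by (simp add: Q0 abs_of_nonneg) (simp add: Q_def int Bochner_Integration.integral_sum)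
    then show ?thesis using tendsto_sum[of Basis, OF lim] by simp
  qed
  ultimately obtain k where k: "strict_mono k" and AE: "AE x in lebesgue. (\<lambda>n. Q (k n) x) \<longlonglongrightarrow> 0"
    using tendsto_L1_AE_subseq by blast
  define T where "T = t \<circ> k"
  have T_lim: "T \<longlonglongrightarrow> 0" unfolding T_def by (rule LIMSEQ_subseq_LIMSEQ[OF t_lim k])
  have "AE x in lebesgue. x \<in> ball a r \<longrightarrow> (\<lambda>n. (v (x + T n *\<^sub>R h) - v x) /\<^sub>R T n) \<longlonglongrightarrow> w x"
    using AE
  proof eventually_elim
    case (elim x)
    show ?case
    proof
      assume x: "x \<in> ball a r"
      then have xR: "x \<in> ball a R" using r by auto
      have "(norm (x - a))\<^sup>2 < r\<^sup>2"
        using x r by (intro power_strict_mono) (auto simp: dist_norm norm_minus_commute)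
      then have b_pos: "0 < ?b x" by (intro flat_exp_0_pos) (simp add: power2_norm_eq_inner)
      have "(\<lambda>n. x + T n *\<^sub>R h) \<longlonglongrightarrow> x + 0 *\<^sub>R h"
        by (intro tendsto_intros T_lim)
      then have "\<forall>\<^sub>F n in sequentially. x + T n *\<^sub>R h \<in> ball a R"
        using topological_tendstoD[OF _ open_ball, of _ x] xR by auto
      then have inside: "\<forall>\<^sub>F n in sequentially. x + T n *\<^sub>R h \<in> cball a R"
        by eventually_elim auto
      show "(\<lambda>n. (v (x + T n *\<^sub>R h) - v x) /\<^sub>R T n) \<longlonglongrightarrow> w x"
        unfolding tendsto_componentwise_iff[of _ "w x"]
      proof
        fix i :: 'b assume i: "i \<in> Basis"
        have le: "E (T n) i x \<le> Q (k n) x" for n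
          unfolding Q_def T_def o_def by (rule member_le_sum) (auto simp: i E0)
        have "(\<lambda>n. E (T n) i x) \<longlonglongrightarrow> 0"
          by (rule tendsto_sandwich[OF _ _ tendsto_const elim]) (auto simp: E0 le)
        then have "(\<lambda>n. E (T n) i x / ?b x) \<longlonglongrightarrow> 0 / ?b x"
          by (intro tendsto_divide tendsto_const) (use b_pos in auto)
        then have "(\<lambda>n. \<bar>(?I (x + T n *\<^sub>R h) * (v (x + T n *\<^sub>R h) \<bullet> i) - ?I x * (v x \<bullet> i)) / T n
            - ?I x * (w x \<bullet> i)\<bar>) \<longlonglongrightarrow> 0"
          using b_pos by (simp add: E_def)
        then have "(\<lambda>n. (?I (x + T n *\<^sub>R h) * (v (x + T n *\<^sub>R h) \<bullet> i) - ?I x * (v x \<bullet> i)) / T n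
            - ?I x * (w x \<bullet> i)) \<longlonglongrightarrow> 0"
          by (rule tendsto_rabs_zero_cancel)
        moreover have "\<forall>\<^sub>F n in sequentially. (?I (x + T n *\<^sub>R h) * (v (x + T n *\<^sub>R h) \<bullet> i) - ?I x * (v x \<bullet> i)) / T n
            - ?I x * (w x \<bullet> i) = ((v (x + T n *\<^sub>R h) - v x) /\<^sub>R T n) \<bullet> i - w x \<bullet> i"
          using inside by eventually_elim (use xR in \<open>auto simp: inner_diff_left divide_inverse_commute\<close>)
        ultimately have "(\<lambda>n. ((v (x + T n *\<^sub>R h) - v x) /\<^sub>R T n) \<bullet> i - w x \<bullet> i) \<longlonglongrightarrow> 0"
          by (rule Lim_transform_eventually)
        then show "(\<lambda>n. ((v (x + T n *\<^sub>R h) - v x) /\<^sub>R T n) \<bullet> i) \<longlonglongrightarrow> w x \<bullet> i"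
          by (rule LIM_zero_cancel)
      qed
    qed
  qed
  with T_lim that[of T] show ?thesis by (simp add: T_def t_pos)
qed

text \<open>
  Applying \<open>difference_quotient_AE_subsequence\<close> to the pair \<open>(u, g)\<close> makes the sequence \<open>T\<close> common to both
  functions. It may depend on the point, and in particular on the ball that is chosen around it, so
  countably many balls covering \<open>\<Omega>\<close> suffice.
\<close>
lemma weak_directional_derivatives_AE:
  fixes u :: "'a::euclidean_space \<Rightarrow> 'b::euclidean_space" and g :: "'a \<Rightarrow> 'c::euclidean_space"
  assumes "open \<Omega>" and u: "has_weak_derivative u Du \<Omega>" and g: "has_weak_derivative g Dg \<Omega>"
  shows "AE x in lebesgue. x \<in> \<Omega> \<longrightarrow> (\<exists>T. (\<forall>n. 0 < T n) \<and> T \<longlonglongrightarrow> 0 \<and>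
    (\<lambda>n. (u (x + T n *\<^sub>R h) - u x) /\<^sub>R T n) \<longlonglongrightarrow> blinfun_apply (Du x) h \<and>
    (\<lambda>n. (g (x + T n *\<^sub>R h) - g x) /\<^sub>R T n) \<longlonglongrightarrow> blinfun_apply (Dg x) h)"
    (is "AE x in lebesgue. x \<in> \<Omega> \<longrightarrow> ?P x")
proof -
  have local: "AE x in lebesgue. x \<in> ball a r \<longrightarrow> ?P x" if r: "0 < r" and sub: "cball a (2 * r) \<subseteq> \<Omega>" for a r
  proof -
    let ?v = "\<lambda>x. (u x, g x)" and ?w = "\<lambda>x. (blinfun_apply (Du x) h, blinfun_apply (Dg x) h)"
    note U = weak_derivative_component[OF u sub] and G = weak_derivative_component[OF g sub]
    obtain T :: "nat \<Rightarrow> real" where T: "\<And>n. 0 < T n" "T \<longlonglongrightarrow> 0" and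
      AE: "AE x in lebesgue. x \<in> ball a r \<longrightarrow> (\<lambda>n. (?v (x + T n *\<^sub>R h) - ?v x) /\<^sub>R T n) \<longlonglongrightarrow> ?w x"
    proof (rule difference_quotient_AE_subsequence[where v="?v" and w="?w" and a=a and r=r and R="2 * r" and h=h])
      show "integrable lebesgue (\<lambda>x. indicator (cball a (2 * r)) x * (?v x \<bullet> i))"
        "integrable lebesgue (\<lambda>x. indicator (cball a (2 * r)) x * (?w x \<bullet> i))"
        if "i \<in> Basis" for i
        using that U(1,2) G(1,2) by (auto simp: Basis_prod_def)
      show "(LINT x|lebesgue. frechet_derivative \<psi> (at x) h * (indicator (cball a (2 * r)) x * (?v x \<bullet> i))) =
        - (LINT x|lebesgue. \<psi> x * (indicator (cball a (2 * r)) x * (?w x \<bullet> i)))"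
        if "i \<in> Basis" "cball b r \<subseteq> cball a (2 * r)" "\<psi> \<in> bump_polys b r" for i b \<psi>
        using that(1) U(3)[OF r that(2,3)] G(3)[OF r that(2,3)] by (auto simp: Basis_prod_def)
    qed (use r in auto)
    show ?thesis
      using AE
    proof eventually_elim
      case (elim x)
      show ?case
      proof
        assume "x \<in> ball a r"
        with elim have "(\<lambda>n. (?v (x + T n *\<^sub>R h) - ?v x) /\<^sub>R T n) \<longlonglongrightarrow> ?w x" by blast
        from tendsto_fst[OF this] tendsto_snd[OF this] T show "?P x"
          by (intro exI[of _ T]) simp
      qed
    qed
  qed
  define \<F> where "\<F> = {ball a r | a r. 0 < r \<and> cball a (2 * r) \<subseteq> \<Omega>}"
  have cover: "\<Omega> \<subseteq> \<Union>\<F>"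
  proof
    fix x assume "x \<in> \<Omega>"
    then obtain e where "0 < e" "cball x e \<subseteq> \<Omega>"
      using \<open>open \<Omega>\<close> open_contains_cball by blast
    then show "x \<in> \<Union>\<F>"
      unfolding \<F>_def by (intro UnionI[of "ball x (e / 2)"] CollectI exI[of _ x] exI[of _ "e / 2"]) auto
  qed
  obtain \<F>' where \<F>': "\<F>' \<subseteq> \<F>" "countable \<F>'" "\<Union>\<F>' = \<Union>\<F>"
    by (rule Lindelof[of \<F>]) (auto simp: \<F>_def)
  have "AE x in lebesgue. \<forall>S\<in>\<F>'. x \<in> S \<longrightarrow> ?P x"
  proof (rule AE_ball_countable'[OF _ \<F>'(2)])
    fix S assume "S \<in> \<F>'"
    with \<F>'(1) obtain a r where "S = ball a r" "0 < r" "cball a (2 * r) \<subseteq> \<Omega>"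
      unfolding \<F>_def by blast
    then show "AE x in lebesgue. x \<in> S \<longrightarrow> ?P x" using local by simp
  qed
  then show ?thesis
    by eventually_elim (use cover \<F>'(3) in blast)
qed

section \<open>From difference quotients to the inequality\<close>

text \<open>
  If \<open>A \<noteq> 0\<close> then \<open>y n\<close> tends to \<open>z\<close> through values different from \<open>z\<close>. For every \<open>c > l\<close> the limsup
  yields \<open>norm (y - z) \<le> c * norm (f y - f z)\<close> near \<open>z\<close>; dividing this by \<open>T n\<close> and letting
  first \<open>n \<rightarrow> \<infinity>\<close> and then \<open>c \<rightarrow> l\<close> gives the claim.
\<close>
lemma inverse_slope_bound_along_sequence:
  fixes f :: "'b::real_normed_vector \<Rightarrow> 'c::real_normed_vector"
  assumes T: "\<And>n. 0 < T n" "T \<longlonglongrightarrow> 0"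
    and A: "(\<lambda>n. (y n - z) /\<^sub>R T n) \<longlonglongrightarrow> A"
    and B: "(\<lambda>n. (f (y n) - f z) /\<^sub>R T n) \<longlonglongrightarrow> B"
    and L: "inverse_slope f z = ennreal l" "0 \<le> l"
  shows "norm A \<le> norm B * l"
proof (cases "A = 0")
  case True
  with L show ?thesis by simp
next
  case False
  have "(\<lambda>n. T n *\<^sub>R ((y n - z) /\<^sub>R T n)) \<longlonglongrightarrow> 0 *\<^sub>R A"
    by (intro tendsto_scaleR T A)
  moreover have "T n *\<^sub>R ((y n - z) /\<^sub>R T n) = y n - z" for n
    using T(1)[of n] by simp
  ultimately have "(\<lambda>n. y n - z) \<longlonglongrightarrow> 0" by simp
  then have "y \<longlonglongrightarrow> z" by (rule LIM_zero_cancel)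
  moreover have "\<forall>\<^sub>F n in sequentially. y n \<noteq> z"
    using tendsto_imp_eventually_ne[OF A False] by eventually_elim auto
  ultimately have y: "filterlim y (at z) sequentially"
    by (simp add: filterlim_at)
  have "norm A \<le> c * norm B" if "l < c" for c
  proof -
    have "0 < c" using that L by linarith
    have "Limsup (at z) (\<lambda>y. ennreal (norm (y - z)) / ennreal (norm (f y - f z))) < ennreal c"
      using L that by (simp add: inverse_slope_def ennreal_lessI)
    from Limsup_lessD[OF this]
    have "\<forall>\<^sub>F y in at z. norm (y - z) \<le> c * norm (f y - f z)"
      using eventually_neq_at_within[of z z UNIV]
    proof eventually_elim
      case (elim y)
      \<comment> \<open>Otherwise the quotient would be \<open>top\<close>, since \<open>y \<noteq> z\<close>.\<close>
      have "f y \<noteq> f z"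
        using elim by (auto simp: ennreal_divide_zero)
      with elim have "ennreal (norm (y - z) / norm (f y - f z)) < ennreal c"
        by (simp add: divide_ennreal)
      then have "norm (y - z) / norm (f y - f z) < c"
        using \<open>0 < c\<close> by (simp add: ennreal_less_iff)
      with \<open>f y \<noteq> f z\<close> show ?case by (simp add: pos_divide_less_eq)
    qed
    then have ev: "\<forall>\<^sub>F n in sequentially. norm (y n - z) \<le> c * norm (f (y n) - f z)"
      using y by (auto simp: filterlim_iff)
    have "\<forall>\<^sub>F n in sequentially. norm ((y n - z) /\<^sub>R T n) \<le> c * norm ((f (y n) - f z) /\<^sub>R T n)"
      using ev
    proof eventually_elim
      case (elim n)
      from mult_left_mono[OF this, of "inverse (T n)"] T(1)[of n] show ?case
        by (simp add: mult.left_commute)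
    qed
    moreover have "(\<lambda>n. norm ((y n - z) /\<^sub>R T n)) \<longlonglongrightarrow> norm A"
      "(\<lambda>n. c * norm ((f (y n) - f z) /\<^sub>R T n)) \<longlonglongrightarrow> c * norm B"
      by (intro tendsto_intros A B)+
    ultimately show ?thesis by (intro tendsto_le[OF sequentially_bot]) auto
  qed
  note le = this
  show ?thesis
  proof (rule field_le_epsilon)
    fix e :: real assume "0 < e"
    let ?d = "e / (norm B + 1)"
    have nB: "0 < norm B + 1" by (simp add: add_nonneg_pos)
    with \<open>0 < e\<close> have "0 < ?d" by simp
    have "norm A \<le> (l + ?d) * norm B" using \<open>0 < ?d\<close> by (intro le) auto
    also have "\<dots> \<le> norm B * l + ?d * (norm B + 1)"
      using \<open>0 < ?d\<close> by (simp only: distrib_left distrib_right) (simp add: mult.commute)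
    also have "?d * (norm B + 1) = e" using nB by simp
    finally show "norm A \<le> norm B * l + e" .
  qed
qed

theorem theorem2p1:
  fixes \<Omega> :: "(real ^ 'n) set"
    and f :: "real ^ 'm \<Rightarrow> real ^ 'l"
    and u :: "real ^ 'n \<Rightarrow> real ^ 'm"
    and Du :: "real ^ 'n \<Rightarrow> (real ^ 'n) \<Rightarrow>\<^sub>L (real ^ 'm)"
    and Dfu :: "real ^ 'n \<Rightarrow> (real ^ 'n) \<Rightarrow>\<^sub>L (real ^ 'l)"
  assumes "open \<Omega>"
    and "f \<in> borel_measurable borel"
    and "u \<in> W11_loc \<Omega>"
    and "f \<circ> u \<in> W11_loc \<Omega>"
    and "has_weak_derivative u Du \<Omega>"
    and "has_weak_derivative (f \<circ> u) Dfu \<Omega>"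
  shows "AE x\<in>\<Omega> in lebesgue. \<forall>h.
           ennreal (norm (blinfun_apply (Du x) h))
             \<le> times_top (ennreal (norm (blinfun_apply (Dfu x) h))) (inverse_slope f (u x))"
proof -
  obtain D :: "(real ^ 'n) set" where "countable D"
    and dense: "\<And>X. open X \<Longrightarrow> X \<noteq> {} \<Longrightarrow> \<exists>d\<in>D. d \<in> X"
    using countable_dense_setE by blast
  have "AE x in lebesgue. \<forall>h\<in>D. x \<in> \<Omega> \<longrightarrow> (\<exists>T. (\<forall>n. 0 < T n) \<and> T \<longlonglongrightarrow> 0 \<and>
    (\<lambda>n. (u (x + T n *\<^sub>R h) - u x) /\<^sub>R T n) \<longlonglongrightarrow> blinfun_apply (Du x) h \<and>
    (\<lambda>n. ((f \<circ> u) (x + T n *\<^sub>R h) - (f \<circ> u) x) /\<^sub>R T n) \<longlonglongrightarrow> blinfun_apply (Dfu x) h)"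
    by (intro AE_ball_countable'[OF _ \<open>countable D\<close>] weak_directional_derivatives_AE assms)
  then show ?thesis
  proof eventually_elim
    case (elim x)
    show ?case
    proof (intro impI allI)
      fix h
      assume x: "x \<in> \<Omega>"
      show "ennreal (norm (blinfun_apply (Du x) h))
             \<le> times_top (ennreal (norm (blinfun_apply (Dfu x) h))) (inverse_slope f (u x))"
      proof (cases "inverse_slope f (u x)")
        case (real l)
        let ?C = "{h. norm (blinfun_apply (Du x) h) \<le> norm (blinfun_apply (Dfu x) h) * l}"
        \<comment> \<open>Since \<open>l\<close> is finite, the admissible directions form a closed set, so the dense set \<open>D\<close>
          decides for all of them.\<close>
        have "D \<subseteq> ?C"
        proof
          fix d assume "d \<in> D"
          with elim x obtain T where "\<And>n. 0 < T n" "T \<longlonglongrightarrow> 0"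
            "(\<lambda>n. (u (x + T n *\<^sub>R d) - u x) /\<^sub>R T n) \<longlonglongrightarrow> blinfun_apply (Du x) d"
            "(\<lambda>n. (f (u (x + T n *\<^sub>R d)) - f (u x)) /\<^sub>R T n) \<longlonglongrightarrow> blinfun_apply (Dfu x) d"
            by auto
          from inverse_slope_bound_along_sequence[OF this real(2,1)] show "d \<in> ?C" by simp
        qed
        moreover have "closed ?C"
          by (intro closed_Collect_le continuous_intros)
        then have "open (- ?C)" by (rule open_Compl)
        ultimately have "- ?C = {}" using dense by blast
        then have "h \<in> ?C" by blast
        with real show ?thesis
          by (simp add: times_top_def ennreal_mult'[symmetric] ennreal_leI)
      qed (simp add: times_top_def)
    qed
  qed
qed

end
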